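(* Let $\mathcal{L}$ be a propositional language and let $\mathcal{M}=\{\mathbf{M}_i\}_{i\in I}$ be a uniform bundle of $\mathcal{L}$-matrices. Then the $\mathcal{M}$-consequence $\vdash_{\mathcal{M}}$ is uniform.
   Context: $\mathcal{L}$ is an abstract propositional language, given by a set $\mathcal{V}_{\mathcal{L}}$ of variables, a set of constants and a set of finitary connectives. $\mathbf{Fm}_{\mathcal{L}}$ is the set of all $\mathcal{L}$-formulae; $\mathcal{V}(\alpha)$ is the set of variables occurring in $\alpha$, and $\mathcal{V}(X)=\bigcup_{\alpha\in X}\mathcal{V}(\alpha)$ for $X\subseteq\mathbf{Fm}_{\mathcal{L}}$. For $\mathcal{V}\subseteq\mathcal{V}_{\mathcal{L}}$, $\mathbf{Fm}_{\mathcal{L}}[\mathcal{V}]=\{\alpha\in\mathbf{Fm}_{\mathcal{L}} : \mathcal{V}(\alpha)\subseteq\mathcal{V}\}$. An $\mathcal{L}$-matrix is a pair $\mathbf{M}=\langle\mathbf{A},D\rangle$ with $\mathbf{A}$ an algebra of the signature of $\mathcal{L}$ and $D\subseteq|\mathbf{A}|$ (its logical filter). $X\models_{\mathbf{M}}\alpha$ means: for every valuation $v$ in $\mathbf{A}$ (homomorphism from the formula algebra to $\mathbf{A}$), if $v[X]\subseteq D$ then $v[\alpha]\in D$. For a nonempty family $\mathcal{M}=\{\mathbf{M}_i\}_{i\in I}$, the $\mathcal{M}$-consequence is defined by: $X\vdash_{\mathcal{M}}\alpha$ iff $X\models_{\mathbf{M}_i}\alpha$ for each $i\in I$. A nonempty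 family $\{\langle\mathbf{A}_i,D_i\rangle\}_{i\in I}$ of $\mathcal{L}$-matrices is a bundle if the algebras $\mathbf{A}_i$ are pairwise isomorphic. For an $\mathcal{L}$-matrix $\mathbf{M}=\langle\mathbf{A},D\rangle$, $\mathfrak{S}(\mathbf{M})$ is the set of all $X\subseteq\mathbf{Fm}_{\mathcal{L}}$ such that $X=\{\alpha\in\mathbf{Fm}_{\mathcal{L}} : v[\alpha]\in D\}$ for some valuation $v$ in $\mathbf{A}$. A bundle $\{\mathbf{M}_i\}_{i\in I}$ is uniform if for all $X,Y\subseteq\mathbf{Fm}_{\mathcal{L}}$ with $X\subseteq\mathbf{Fm}_{\mathcal{L}}[\mathcal{V}_{\mathcal{L}}\setminus\mathcal{V}(Y)]$, all $i,j\in I$, all $Z_i\in\mathfrak{S}(\mathbf{M}_i)$ and $Z_j\in\mathfrak{S}(\mathbf{M}_j)$, there are $k\in I$ and $Z_k\in\mathfrak{S}(\mathbf{M}_k)$ such that: if $X\subseteq Z_i$ and $Y\subseteq Z_j\subsetneq\mathbf{Fm}_{\mathcal{L}}$, then $Z_i\cap\mathbf{Fm}_{\mathcal{L}}[\mathcal{V}_{\mathcal{L}}\setminus\mathcal{V}(Y)]=Z_k\cap\mathbf{Fm}_{\mathcal{L}}[\mathcal{V}_{\mathcal{L}}\setminus\mathcal{V}(Y)]$ and $Z_j\cap\mathbf{Fm}_{\mathcal{L}}[\mathcal{V}(Y)]\subseteq Z_k$. A consequence relation $\vdash$ in $\mathcal{L}$ is uniform if for all $X,Y\subseteq\mathbf{Fm}_{\mathcal{L}}$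 and $\alpha\in\mathbf{Fm}_{\mathcal{L}}$ such that $\mathcal{V}(X\cup\{\alpha\})\cap\mathcal{V}(Y)=\varnothing$ and $Y$ is consistent (i.e. $Y\not\vdash\beta$ for some $\beta\in\mathbf{Fm}_{\mathcal{L}}$): $X\cup Y\vdash\alpha$ implies $X\vdash\alpha$. *)

theory Defs
  imports "HOL-Library.FuncSet"
begin

section \<open>Propositional languages and formulae\<close>

text \<open>
  The sets of variables, constants and connectives are subsets of types, so that they may be empty
  (a language need not have constants, for instance).
\<close>

record ('v, 'c, 'f) lang =
  lvars :: "'v set"
  lconsts :: "'c set"
  lconns :: "'f set"
  arity :: "'f \<Rightarrow> nat"

datatype (vars_fm: 'v, 'c, 'f) fm =
  Var 'v | Const 'c | App 'f "('v, 'c, 'f) fm list"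

inductive_set Fm :: "('v, 'c, 'f) lang \<Rightarrow> ('v, 'c, 'f) fm set"
  for L :: "('v, 'c, 'f) lang" where
  Var: "p \<in> lvars L \<Longrightarrow> Var p \<in> Fm L"
| Const: "c \<in> lconsts L \<Longrightarrow> Const c \<in> Fm L"
| App: "f \<in> lconns L \<Longrightarrow> length \<phi>s = arity L f \<Longrightarrow> (\<And>\<phi>. \<phi> \<in> set \<phi>s \<Longrightarrow> \<phi> \<in> Fm L) \<Longrightarrow> App f \<phi>s \<in> Fm L"

definition vars_of :: "('v, 'c, 'f) fm set \<Rightarrow> 'v set" where
  "vars_of X = (\<Union>\<alpha>\<in>X. vars_fm \<alpha>)"

definition Fm_on :: "('v, 'c, 'f) lang \<Rightarrow> 'v set \<Rightarrow> ('v, 'c, 'f) fm set" where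
  "Fm_on L V = {\<alpha> \<in> Fm L. vars_fm \<alpha> \<subseteq> V}"


section \<open>Algebras of the signature of a language\<close>

record ('c, 'f, 'a) alg =
  carrier :: "'a set"
  cst :: "'c \<Rightarrow> 'a"
  opn :: "'f \<Rightarrow> 'a list \<Rightarrow> 'a"

definition algebra :: "('v, 'c, 'f) lang \<Rightarrow> ('c, 'f, 'a) alg \<Rightarrow> bool" where
  "algebra L A \<longleftrightarrow>
     carrier A \<noteq> {} \<and>
     (\<forall>c\<in>lconsts L. cst A c \<in> carrier A) \<and>
     (\<forall>f\<in>lconns L. \<forall>xs. length xs = arity L f \<longrightarrow> set xs \<subseteq> carrier A \<longrightarrow> opn A f xs \<in> carrier A)"

definition homomorphism ::
  "('v, 'c, 'f) lang \<Rightarrow> ('c, 'f, 'a) alg \<Rightarrow> ('c, 'f, 'b) alg \<Rightarrow> ('a \<Rightarrow> 'b) \<Rightarrow> bool" where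
  "homomorphism L A B h \<longleftrightarrow>
     h \<in> carrier A \<rightarrow> carrier B \<and>
     (\<forall>c\<in>lconsts L. h (cst A c) = cst B c) \<and>
     (\<forall>f\<in>lconns L. \<forall>xs. length xs = arity L f \<longrightarrow> set xs \<subseteq> carrier A \<longrightarrow>
        h (opn A f xs) = opn B f (map h xs))"

definition isomorphic ::
  "('v, 'c, 'f) lang \<Rightarrow> ('c, 'f, 'a) alg \<Rightarrow> ('c, 'f, 'b) alg \<Rightarrow> bool" where
  "isomorphic L A B \<longleftrightarrow> (\<exists>h. homomorphism L A B h \<and> bij_betw h (carrier A) (carrier B))"

definition fm_algebra :: "('v, 'c, 'f) lang \<Rightarrow> ('c, 'f, ('v, 'c, 'f) fm) alg" where
  "fm_algebra L = \<lparr>carrier = Fm L, cst = Const, opn = App\<rparr>"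

text \<open>
  Values of a valuation outside \<^term>\<open>Fm L\<close> are arbitrary; the notions below only ever
  look at formulae of the language.
\<close>

definition valuation ::
  "('v, 'c, 'f) lang \<Rightarrow> ('c, 'f, 'a) alg \<Rightarrow> (('v, 'c, 'f) fm \<Rightarrow> 'a) \<Rightarrow> bool" where
  "valuation L A v \<longleftrightarrow> homomorphism L (fm_algebra L) A v"


section \<open>Matrices, bundles and consequence\<close>

record ('c, 'f, 'a) matrix =
  malg :: "('c, 'f, 'a) alg"
  mfilter :: "'a set"

definition is_matrix :: "('v, 'c, 'f) lang \<Rightarrow> ('c, 'f, 'a) matrix \<Rightarrow> bool" where
  "is_matrix L M \<longleftrightarrow> algebra L (malg M) \<and> mfilter M \<subseteq> carrier (malg M)"

definition matrix_conseq ::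
  "('v, 'c, 'f) lang \<Rightarrow> ('c, 'f, 'a) matrix \<Rightarrow> ('v, 'c, 'f) fm set \<Rightarrow> ('v, 'c, 'f) fm \<Rightarrow> bool" where
  "matrix_conseq L M X \<alpha> \<longleftrightarrow>
     (\<forall>v. valuation L (malg M) v \<longrightarrow> v ` X \<subseteq> mfilter M \<longrightarrow> v \<alpha> \<in> mfilter M)"

definition family_conseq ::
  "('v, 'c, 'f) lang \<Rightarrow> 'i set \<Rightarrow> ('i \<Rightarrow> ('c, 'f, 'a) matrix) \<Rightarrow>
     ('v, 'c, 'f) fm set \<Rightarrow> ('v, 'c, 'f) fm \<Rightarrow> bool" where
  "family_conseq L I M X \<alpha> \<longleftrightarrow> (\<forall>i\<in>I. matrix_conseq L (M i) X \<alpha>)"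

text \<open>
  The algebras of a bundle are pairwise isomorphic, hence equipotent, so it is no restriction that
  their carriers are subsets of one type.
\<close>

definition matrix_bundle :: "('v, 'c, 'f) lang \<Rightarrow> 'i set \<Rightarrow> ('i \<Rightarrow> ('c, 'f, 'a) matrix) \<Rightarrow> bool" where
  "matrix_bundle L I M \<longleftrightarrow>
     I \<noteq> {} \<and>
     (\<forall>i\<in>I. is_matrix L (M i)) \<and>
     (\<forall>i\<in>I. \<forall>j\<in>I. isomorphic L (malg (M i)) (malg (M j)))"

definition val_sets ::
  "('v, 'c, 'f) lang \<Rightarrow> ('c, 'f, 'a) matrix \<Rightarrow> ('v, 'c, 'f) fm set set" where
  "val_sets L M =
     {X. X \<subseteq> Fm L \<and> (\<exists>v. valuation L (malg M) v \<and> X = {\<alpha> \<in> Fm L. v \<alpha> \<in> mfilter M})}"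

definition uniform_bundle ::
  "('v, 'c, 'f) lang \<Rightarrow> 'i set \<Rightarrow> ('i \<Rightarrow> ('c, 'f, 'a) matrix) \<Rightarrow> bool" where
  "uniform_bundle L I M \<longleftrightarrow>
     matrix_bundle L I M \<and>
     (\<forall>X Y. X \<subseteq> Fm L \<longrightarrow> Y \<subseteq> Fm L \<longrightarrow> X \<subseteq> Fm_on L (lvars L - vars_of Y) \<longrightarrow>
        (\<forall>i\<in>I. \<forall>j\<in>I. \<forall>Zi\<in>val_sets L (M i). \<forall>Zj\<in>val_sets L (M j).
           \<exists>k\<in>I. \<exists>Zk\<in>val_sets L (M k).
             X \<subseteq> Zi \<and> Y \<subseteq> Zj \<and> Zj \<subset> Fm L \<longrightarrow>
               Zi \<inter> Fm_on L (lvars L - vars_of Y) = Zk \<inter> Fm_on L (lvars L - vars_of Y) \<and>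
               Zj \<inter> Fm_on L (vars_of Y) \<subseteq> Zk))"

definition consistent ::
  "('v, 'c, 'f) lang \<Rightarrow> (('v, 'c, 'f) fm set \<Rightarrow> ('v, 'c, 'f) fm \<Rightarrow> bool) \<Rightarrow>
     ('v, 'c, 'f) fm set \<Rightarrow> bool" where
  "consistent L C Y \<longleftrightarrow> (\<exists>\<beta>\<in>Fm L. \<not> C Y \<beta>)"

definition uniform_conseq ::
  "('v, 'c, 'f) lang \<Rightarrow> (('v, 'c, 'f) fm set \<Rightarrow> ('v, 'c, 'f) fm \<Rightarrow> bool) \<Rightarrow> bool" where
  "uniform_conseq L C \<longleftrightarrow>
     (\<forall>X Y \<alpha>. X \<subseteq> Fm L \<longrightarrow> Y \<subseteq> Fm L \<longrightarrow> \<alpha> \<in> Fm L \<longrightarrow>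
        vars_of (X \<union> {\<alpha>}) \<inter> vars_of Y = {} \<longrightarrow> consistent L C Y \<longrightarrow>
        C (X \<union> Y) \<alpha> \<longrightarrow> C X \<alpha>)"

text \<open>
  \<^const>\<open>family_conseq\<close> is a consequence relation in the usual (Tarskian) sense.
\<close>

lemma family_conseq_refl: "\<alpha> \<in> X \<Longrightarrow> family_conseq L I M X \<alpha>"
  unfolding family_conseq_def matrix_conseq_def by blast

lemma family_conseq_mono: "family_conseq L I M X \<alpha> \<Longrightarrow> X \<subseteq> Y \<Longrightarrow> family_conseq L I M Y \<alpha>"
  unfolding family_conseq_def matrix_conseq_def by blast

lemma family_conseq_trans:
  "family_conseq L I M Y \<alpha> \<Longrightarrow> (\<And>\<beta>. \<beta> \<in> Y \<Longrightarrow> family_conseq L I M X \<beta>) \<Longrightarrow> family_conseq L I M X \<alpha>"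
  unfolding family_conseq_def matrix_conseq_def by blast

end

theory Submission imports Defs begin

text \<open>A valuation matters for consequence only through the set of formulae it makes
  designated, so \<alpha> follows from X iff every member of \<open>val_sets\<close> containing X
  contains \<alpha> (\<open>family_conseq_iff_val_sets\<close>). Given such a set \<open>Zi\<close>
  containing X, consistency of Y supplies a proper set \<open>Zj\<close> containing Y. Uniformity of
  the bundle amalgamates the two: some \<open>Zk\<close> agrees with \<open>Zi\<close> on formulae
  sharing no variable with Y and contains the formulae of \<open>Zj\<close> in the variables of Y.
  Hence X \<union> Y lies in \<open>Zk\<close>, so \<alpha> does too, and agreement carries \<alpha>
  back to \<open>Zi\<close>.\<close>

lemma vars_fm_subset_lvars: "\<alpha> \<in> Fm L \<Longrightarrow> vars_fm \<alpha> \<subseteq> lvars L"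
  by (induction rule: Fm.induct) auto

lemma Fm_on_vars_of: "Y \<subseteq> Fm L \<Longrightarrow> Y \<subseteq> Fm_on L (vars_of Y)"
  unfolding Fm_on_def vars_of_def by blast

lemma disjoint_vars_Fm_on:
  assumes "X \<subseteq> Fm L" "vars_of X \<inter> V = {}"
  shows "X \<subseteq> Fm_on L (lvars L - V)"
  using assms vars_fm_subset_lvars unfolding Fm_on_def vars_of_def by blast

text \<open>Members of \<open>val_sets\<close> contain only formulae of L, whereas
  \<open>matrix_conseq\<close> evaluates arbitrary terms; the assumptions on X and \<alpha> bridge
  this gap.\<close>

lemma matrix_conseq_iff_val_sets:
  assumes "X \<subseteq> Fm L" "\<alpha> \<in> Fm L"
  shows "matrix_conseq L M X \<alpha> \<longleftrightarrow> (\<forall>Z\<in>val_sets L M. X \<subseteq> Z \<longrightarrow> \<alpha> \<in> Z)"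
proof -
  have "matrix_conseq L M X \<alpha> \<longleftrightarrow>
      (\<forall>v. valuation L (malg M) v \<longrightarrow>
        X \<subseteq> {\<beta> \<in> Fm L. v \<beta> \<in> mfilter M} \<longrightarrow> \<alpha> \<in> {\<beta> \<in> Fm L. v \<beta> \<in> mfilter M})"
    using assms unfolding matrix_conseq_def by blast
  also have "\<dots> \<longleftrightarrow> (\<forall>Z\<in>val_sets L M. X \<subseteq> Z \<longrightarrow> \<alpha> \<in> Z)"
    unfolding val_sets_def by blast
  finally show ?thesis .
qed

lemma family_conseq_iff_val_sets:
  assumes "X \<subseteq> Fm L" "\<alpha> \<in> Fm L"
  shows "family_conseq L I M X \<alpha> \<longleftrightarrow> (\<forall>i\<in>I. \<forall>Z\<in>val_sets L (M i). X \<subseteq> Z \<longrightarrow> \<alpha> \<in> Z)"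
  unfolding family_conseq_def by (simp add: matrix_conseq_iff_val_sets[OF assms])

text \<open>Elimination form: in the definition the inclusions and properness stand inside the
  existential quantifiers over \<open>k\<close> and \<open>Zk\<close>; here they become
  premises.\<close>

lemma uniform_bundleD:
  assumes "uniform_bundle L I M"
    and "Y \<subseteq> Fm L" "X \<subseteq> Fm_on L (lvars L - vars_of Y)"
    and "i \<in> I" "j \<in> I" "Zi \<in> val_sets L (M i)" "Zj \<in> val_sets L (M j)"
    and "X \<subseteq> Zi" "Y \<subseteq> Zj" "Zj \<subset> Fm L"
  obtains k Zk where "k \<in> I" "Zk \<in> val_sets L (M k)"
    "Zi \<inter> Fm_on L (lvars L - vars_of Y) = Zk \<inter> Fm_on L (lvars L - vars_of Y)"
    "Zj \<inter> Fm_on L (vars_of Y) \<subseteq> Zk"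
proof -
  have "X \<subseteq> Fm L"
    using assms(3) by (auto simp: Fm_on_def)
  then have "\<exists>k\<in>I. \<exists>Zk\<in>val_sets L (M k). X \<subseteq> Zi \<and> Y \<subseteq> Zj \<and> Zj \<subset> Fm L \<longrightarrow>
      Zi \<inter> Fm_on L (lvars L - vars_of Y) = Zk \<inter> Fm_on L (lvars L - vars_of Y) \<and>
      Zj \<inter> Fm_on L (vars_of Y) \<subseteq> Zk"
    using assms(1-7) unfolding uniform_bundle_def by simp
  then show thesis
    using assms(8-10) that by blast
qed

theorem proposition2p1:
  fixes L :: "('v, 'c, 'f) lang"
    and I :: "'i set"
    and M :: "'i \<Rightarrow> ('c, 'f, 'a) matrix"
  assumes "uniform_bundle L I M"
  shows "uniform_conseq L (family_conseq L I M)"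
  unfolding uniform_conseq_def
proof (intro allI impI)
  fix X Y :: "('v, 'c, 'f) fm set" and \<alpha>
  assume fm: "X \<subseteq> Fm L" "Y \<subseteq> Fm L" "\<alpha> \<in> Fm L"
    and disj: "vars_of (X \<union> {\<alpha>}) \<inter> vars_of Y = {}"
    and cons: "consistent L (family_conseq L I M) Y"
    and conseq: "family_conseq L I M (X \<union> Y) \<alpha>"
  \<comment> \<open>\<alpha> is included because it, like X, must lie in the region where
    \<open>Zi\<close> and \<open>Zk\<close> agree.\<close>
  have on: "X \<union> {\<alpha>} \<subseteq> Fm_on L (lvars L - vars_of Y)"
    using fm disj by (intro disjoint_vars_Fm_on) auto
  \<comment> \<open>\<open>Zj\<close> comes from a valuation refuting \<beta> while satisfying Y;
    the missing \<beta> makes \<open>Zj\<close> proper, as uniformity demands.\<close>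
  obtain \<beta> j Zj where j: "\<beta> \<in> Fm L" "j \<in> I" "Zj \<in> val_sets L (M j)" "Y \<subseteq> Zj" "\<beta> \<notin> Zj"
    using cons fm(2) unfolding consistent_def by (auto simp: family_conseq_iff_val_sets)
  have proper: "Zj \<subset> Fm L"
    using j unfolding val_sets_def by blast
  have "\<alpha> \<in> Zi" if i: "i \<in> I" "Zi \<in> val_sets L (M i)" "X \<subseteq> Zi" for i Zi
  proof -
    obtain k Zk where k: "k \<in> I" "Zk \<in> val_sets L (M k)"
      and agree: "Zi \<inter> Fm_on L (lvars L - vars_of Y) = Zk \<inter> Fm_on L (lvars L - vars_of Y)"
      and extend: "Zj \<inter> Fm_on L (vars_of Y) \<subseteq> Zk"
      using uniform_bundleD[OF assms fm(2) _ i(1) j(2) i(2) j(3) i(3) j(4) proper] on by blast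
    \<comment> \<open>X enters through \<open>agree\<close>, Y through
      \<open>extend\<close>.\<close>
    have "X \<union> Y \<subseteq> Zk"
      using i(3) on agree j(4) extend Fm_on_vars_of[OF fm(2)] by blast
    then have "\<alpha> \<in> Zk"
      using conseq fm k by (simp add: family_conseq_iff_val_sets)
    then show "\<alpha> \<in> Zi"
      using on agree by blast
  qed
  then show "family_conseq L I M X \<alpha>"
    using fm by (simp add: family_conseq_iff_val_sets)
qed

end
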